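(* Let $\mathcal{V}=\{x_1,\dots,x_d\}$ and let $\eta_s:\mathcal{V}\to\mathbb{Z}[\mathcal{V}]$ be a solvable update with partition $\mathcal{S}_1,\dots,\mathcal{S}_m$ and matrices $A_{\mathcal{S}_i}$. For each block $\mathcal{S}$ let $P_{\mathcal{S}}$ be an invertible matrix over $\mathbb{A}$ such that $J(A_{\mathcal{S}})=P_{\mathcal{S}}\cdot A_{\mathcal{S}}\cdot P_{\mathcal{S}}^{-1}$ is the Jordan normal form of $A_{\mathcal{S}}$, and let $\vartheta:\mathcal{V}\to\mathbb{A}[\mathcal{V}]$ be the automorphism defined blockwise by $\vec{\vartheta}_{\mathcal{S}}=P_{\mathcal{S}}\cdot\vec{x}_{\mathcal{S}}$ (i.e., the vector of the $\vartheta(x_j)$, $j\in\mathcal{S}$, equals $P_{\mathcal{S}}\cdot \vec{x}_{\mathcal{S}}$), such that $\eta_t=\vartheta^{-1}\circ\eta_s\circ\vartheta$ is a twn-update. If $\mathrm{cl}_t$ (mapping each $x_i$ to $\mathrm{cl}_t(x_i)$) is a closed form of $\eta_t$ with start value $n_0$, then $\mathrm{cl}_s=\vartheta\circ\mathrm{cl}_t\circ\vartheta^{-1}$, i.e. $\mathrm{cl}_s(v)=\vartheta^{-1}(v)\,[w/\mathrm{cl}_t(w)\mid w\in\mathcal{V}]\,[w/\vartheta(w)\mid w\in\mathcal{V}]$ for all $v\in\mathcal{V}$, is a closed form of $\eta_s$ with start value $n_0$.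
   Context: $\mathbb{A}$ denotes the field of algebraic numbers. An update $\eta:\mathcal{V}\to\mathbb{Z}[\mathcal{V}]$ is solvable if there is a partition $\mathcal{S}_1,\dots,\mathcal{S}_m$ of $\mathcal{V}$ such that for each $i$ the vector $\vec{\eta}_{\mathcal{S}_i}$ of all $\eta(x_j)$, $j\in\mathcal{S}_i$, equals $A_{\mathcal{S}_i}\vec{x}_{\mathcal{S}_i}+\vec{p}_{\mathcal{S}_i}$ with $A_{\mathcal{S}_i}\in\mathbb{Z}^{|\mathcal{S}_i|\times|\mathcal{S}_i|}$ and $\vec p_{\mathcal{S}_i}$ a vector of polynomials in $\mathbb{Z}[\mathcal{S}_1\cup\dots\cup\mathcal{S}_{i-1}]$. An update $\eta:\mathcal{V}\to\mathbb{A}[\mathcal{V}]$ is twn if $\eta(x_i)=c_i x_i+p_i$ with $c_i\in\mathbb{A}$, $p_i\in\mathbb{A}[x_1,\dots,x_{i-1}]$ for all $i$. Updates are applied to expressions by substituting each variable $v$ by $\eta(v)$; composition is $(\eta_1\circ\eta_2)(v)=\eta_2(v)[w/\eta_1(w)\mid w\in\mathcal{V}]$, and $\eta^n$ is the $n$-fold application. The set of poly-exponential expressions is $\mathbb{PE}=\{\sum_{j=1}^{\ell}p_j\cdot n^{a_j}\cdot b_j^n\mid \ell,a_j\in\mathbb{N},\,b_j\in\mathbb{A},\,p_j\in\mathbb{A}[\mathcal{V}]\}$ with a distinguished variable $n$. An expression $\mathrm{cl}(x_i)\in\mathbb{PE}$ is a closed form for $x_i$ (w.r.t. $\eta$) with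 start value $n_0\in\mathbb{N}$ if for all $\sigma:\mathcal{V}\cup\{n\}\to\mathbb{Z}$ with $\sigma(n)\ge n_0$ we have $\sigma(\mathrm{cl}(x_i))=\sigma(\eta^n(x_i))$ (with $n$ instantiated by $\sigma(n)$); $\mathrm{cl}$ is a closed form of $\eta$ with start value $n_0$ if this holds for every $x_i$. *)

theory Defs
  imports
    "HOL-Library.Poly_Mapping"
    "HOL-Algebra.Algebraic_Closure_Type"
    "Jordan_Normal_Form.Jordan_Normal_Form"
begin

text \<open>The field of algebraic numbers, as the algebraic closure of the rationals.\<close>

type_synonym alg = "rat alg_closure"


subsection \<open>Multivariate polynomials\<close>

text \<open>The variable \<open>x\<^sub>i\<close> is represented by its index \<open>i\<close>. A monomial maps each variable to its
  exponent, and a polynomial maps each monomial to its coefficient.\<close>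

type_synonym 'a mpoly = "(nat \<Rightarrow>\<^sub>0 nat) \<Rightarrow>\<^sub>0 'a"

definition mconst :: "'a::comm_ring_1 \<Rightarrow> 'a mpoly" where
  "mconst c = Poly_Mapping.single 0 c"

definition mvar :: "nat \<Rightarrow> 'a::comm_ring_1 mpoly" where
  "mvar v = Poly_Mapping.single (Poly_Mapping.single v 1) 1"

definition mvars :: "'a::comm_ring_1 mpoly \<Rightarrow> nat set" where
  "mvars p = (\<Union>m \<in> Poly_Mapping.keys p. Poly_Mapping.keys m)"

definition mpolys :: "nat set \<Rightarrow> 'a::comm_ring_1 mpoly set" where
  "mpolys V = {p. mvars p \<subseteq> V}"

text \<open>Evaluation in an arbitrary commutative ring: \<open>h\<close> maps the coefficients into that ring and
  \<open>f\<close> gives the values of the variables.\<close>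

definition meval :: "('a::comm_ring_1 \<Rightarrow> 'b::comm_ring_1) \<Rightarrow> (nat \<Rightarrow> 'b) \<Rightarrow> 'a mpoly \<Rightarrow> 'b" where
  "meval h f p = (\<Sum>m \<in> Poly_Mapping.keys p.
     h (Poly_Mapping.lookup p m) * (\<Prod>v \<in> Poly_Mapping.keys m. f v ^ Poly_Mapping.lookup m v))"

definition msubst :: "(nat \<Rightarrow> 'a::comm_ring_1 mpoly) \<Rightarrow> 'a mpoly \<Rightarrow> 'a mpoly" where
  "msubst = meval mconst"

definition mvalue :: "(nat \<Rightarrow> int) \<Rightarrow> 'a::comm_ring_1 mpoly \<Rightarrow> 'a" where
  "mvalue \<sigma> = meval id (\<lambda>v. of_int (\<sigma> v))"


subsection \<open>Updates\<close>

text \<open>Only the values of an update on the variable set \<open>V\<close> are meaningful.\<close>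

type_synonym 'a update = "nat \<Rightarrow> 'a mpoly"

definition is_update :: "nat set \<Rightarrow> 'a::comm_ring_1 update \<Rightarrow> bool" where
  "is_update V \<eta> \<longleftrightarrow> (\<forall>v \<in> V. \<eta> v \<in> mpolys V)"

definition upd_comp :: "'a::comm_ring_1 update \<Rightarrow> 'a update \<Rightarrow> 'a update" (infixl "\<circ>\<^sub>u" 55) where
  "\<eta>\<^sub>1 \<circ>\<^sub>u \<eta>\<^sub>2 = (\<lambda>v. msubst \<eta>\<^sub>1 (\<eta>\<^sub>2 v))"

definition upd_pow :: "'a::comm_ring_1 update \<Rightarrow> nat \<Rightarrow> 'a update" where
  "upd_pow \<eta> k = ((\<lambda>\<tau>. \<eta> \<circ>\<^sub>u \<tau>) ^^ k) mvar"

definition is_upd_inverse :: "nat set \<Rightarrow> 'a::comm_ring_1 update \<Rightarrow> 'a update \<Rightarrow> bool" where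
  "is_upd_inverse V \<theta> \<tau> \<longleftrightarrow>
     is_update V \<tau> \<and> (\<forall>v \<in> V. (\<theta> \<circ>\<^sub>u \<tau>) v = mvar v \<and> (\<tau> \<circ>\<^sub>u \<theta>) v = mvar v)"

text \<open>If \<open>\<theta>\<close> is an automorphism, its inverse is uniquely determined on \<open>V\<close>, so the choice only
  concerns irrelevant values outside \<open>V\<close>.\<close>

definition upd_inv :: "nat set \<Rightarrow> 'a::comm_ring_1 update \<Rightarrow> 'a update" where
  "upd_inv V \<theta> = (SOME \<tau>. is_upd_inverse V \<theta> \<tau>)"

definition upd_of_int :: "int update \<Rightarrow> 'a::comm_ring_1 update" where
  "upd_of_int \<eta> = (\<lambda>v. Poly_Mapping.map of_int (\<eta> v))"

text \<open>An ordered partition of \<open>V\<close>. Each block is given by an enumeration of its elements, which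
  fixes the order of the entries of the vectors and matrices belonging to that block.\<close>

definition is_partition :: "nat set \<Rightarrow> nat list list \<Rightarrow> bool" where
  "is_partition V Ss \<longleftrightarrow> [] \<notin> set Ss \<and> distinct (concat Ss) \<and> set (concat Ss) = V"

definition block_vec :: "'a update \<Rightarrow> nat list \<Rightarrow> 'a mpoly vec" where
  "block_vec \<eta> S = vec_of_list (map \<eta> S)"

definition solvable_with ::
  "nat set \<Rightarrow> int update \<Rightarrow> nat list list \<Rightarrow> (nat \<Rightarrow> int mat) \<Rightarrow> bool" where
  "solvable_with V \<eta> Ss A \<longleftrightarrow>
     is_update V \<eta> \<and> is_partition V Ss \<and>
     (\<forall>i < length Ss.
        A i \<in> carrier_mat (length (Ss ! i)) (length (Ss ! i)) \<and>
        (\<exists>p \<in> carrier_vec (length (Ss ! i)).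
           set\<^sub>v p \<subseteq> mpolys (\<Union>j<i. set (Ss ! j)) \<and>
           block_vec \<eta> (Ss ! i) = map_mat mconst (A i) *\<^sub>v block_vec mvar (Ss ! i) + p))"

definition twn :: "nat \<Rightarrow> 'a::comm_ring_1 update \<Rightarrow> bool" where
  "twn d \<eta> \<longleftrightarrow>
     (\<forall>i \<in> {1..d}. \<exists>c. \<exists>p \<in> mpolys {1..<i}. \<eta> i = mconst c * mvar i + p)"

text \<open>\<open>P\<close> is invertible and \<open>P \<cdot> A \<cdot> P\<^sup>-\<^sup>1\<close> is a Jordan normal form of \<open>A\<close>.\<close>

definition jordan_transformation :: "'a::field mat \<Rightarrow> 'a mat \<Rightarrow> bool" where
  "jordan_transformation A P \<longleftrightarrow>
     (\<exists>Q n_as. jordan_nf A n_as \<and> similar_mat_wit (jordan_matrix n_as) A P Q)"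


subsection \<open>Poly-exponential expressions\<close>

text \<open>\<open>ExpMon a b\<close> stands for \<open>n\<^sup>a \<cdot> b\<^sup>n\<close>. These form a commutative monoid under
  \<open>(n\<^sup>a \<cdot> b\<^sup>n) \<cdot> (n\<^sup>a\<^sup>' \<cdot> b'\<^sup>n) = n\<^sup>a\<^sup>+\<^sup>a\<^sup>' \<cdot> (b \<cdot> b')\<^sup>n\<close>, which has to be written additively in order to
  obtain the ring of formal sums \<open>\<Sum>\<^sub>j p\<^sub>j \<cdot> n\<^sup>a\<^sup>j \<cdot> b\<^sub>j\<^sup>n\<close> as its monoid ring over the
  polynomials.\<close>

datatype 'a expmon = ExpMon (expmon_pow: nat) (expmon_base: 'a)

instantiation expmon :: (comm_monoid_mult) comm_monoid_add
begin

definition zero_expmon :: "'a expmon" where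
  "0 = ExpMon 0 1"

definition plus_expmon :: "'a expmon \<Rightarrow> 'a expmon \<Rightarrow> 'a expmon" where
  "x + y = ExpMon (expmon_pow x + expmon_pow y) (expmon_base x * expmon_base y)"

instance
  by standard (auto simp: zero_expmon_def plus_expmon_def ac_simps)

end

type_synonym pexp = "alg expmon \<Rightarrow>\<^sub>0 alg mpoly"

definition pe_term :: "alg mpoly \<Rightarrow> nat \<Rightarrow> alg \<Rightarrow> pexp" where
  "pe_term p a b = Poly_Mapping.single (ExpMon a b) p"

definition PE :: "nat set \<Rightarrow> pexp set" where
  "PE V = {\<Sum>j=1..l. pe_term (p j) (a j) (b j) | (l::nat) p a b. \<forall>j \<in> {1..l}. p j \<in> mpolys V}"

text \<open>The value of an expression if the variables are instantiated by \<open>\<sigma>\<close> and \<open>n\<close> by \<open>k\<close>.\<close>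

definition pe_value :: "(nat \<Rightarrow> int) \<Rightarrow> nat \<Rightarrow> pexp \<Rightarrow> alg" where
  "pe_value \<sigma> k e = (\<Sum>m \<in> Poly_Mapping.keys e.
     mvalue \<sigma> (Poly_Mapping.lookup e m) * of_nat k ^ expmon_pow m * expmon_base m ^ k)"

text \<open>Substitution of poly-exponential expressions for the variables of a polynomial, and of
  polynomials for the variables (other than \<open>n\<close>) of a poly-exponential expression.\<close>

definition msubst_pe :: "(nat \<Rightarrow> pexp) \<Rightarrow> alg mpoly \<Rightarrow> pexp" where
  "msubst_pe = meval (\<lambda>c. pe_term (mconst c) 0 1)"

definition pe_subst :: "alg update \<Rightarrow> pexp \<Rightarrow> pexp" where
  "pe_subst \<theta> e = Poly_Mapping.map (msubst \<theta>) e"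

definition closed_form_for :: "nat set \<Rightarrow> alg update \<Rightarrow> nat \<Rightarrow> nat \<Rightarrow> pexp \<Rightarrow> bool" where
  "closed_form_for V \<eta> n\<^sub>0 v e \<longleftrightarrow>
     e \<in> PE V \<and> (\<forall>\<sigma> k. k \<ge> n\<^sub>0 \<longrightarrow> pe_value \<sigma> k e = mvalue \<sigma> (upd_pow \<eta> k v))"

definition closed_form :: "nat set \<Rightarrow> alg update \<Rightarrow> nat \<Rightarrow> (nat \<Rightarrow> pexp) \<Rightarrow> bool" where
  "closed_form V \<eta> n\<^sub>0 cl \<longleftrightarrow> (\<forall>v \<in> V. closed_form_for V \<eta> n\<^sub>0 v (cl v))"

end

theory Submission
  imports Defs
begin

text \<open>For a fixed value \<open>k\<close> of \<open>n\<close>, a poly-exponential expression becomes a polynomial, and this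
  specialisation is a ring homomorphism that commutes with substitution. A closed form of
  \<open>\<eta>\<^sub>t\<close> is only known to agree with the iterates of \<open>\<eta>\<^sub>t\<close> at integer points, whereas
  substituting \<open>\<vartheta>\<close> requires evaluation at algebraic points. However, polynomials over a field of
  characteristic 0 that agree at all integer points are equal, so specialising
  \<open>cl\<^sub>t\<close> at \<open>k \<ge> n\<^sub>0\<close> yields \<open>\<eta>\<^sub>t\<^sup>k\<close> itself. The claim then follows from
  \<open>\<vartheta> \<circ> \<eta>\<^sub>t\<^sup>k \<circ> \<vartheta>\<^sup>-\<^sup>1 = \<eta>\<^sub>s\<^sup>k\<close>.\<close>

section \<open>Evaluation homomorphisms on monoid rings and polynomials\<close>

text \<open>One evaluation for monoid rings over an arbitrary index monoid: it covers
  \<open>meval\<close>, where the indices are monomials, and the specialisation of n, where they are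
  the \<open>expmon\<close> exponents.\<close>

definition pm_eval ::
  "('b::comm_ring_1 \<Rightarrow> 'c::comm_ring_1) \<Rightarrow> ('m \<Rightarrow> 'c) \<Rightarrow> ('m \<Rightarrow>\<^sub>0 'b) \<Rightarrow> 'c" where
  "pm_eval h w p = (\<Sum>m \<in> Poly_Mapping.keys p. h (Poly_Mapping.lookup p m) * w m)"

lemma pm_eval_superset:
  assumes "finite S" "Poly_Mapping.keys p \<subseteq> S" "h 0 = 0"
  shows "pm_eval h w p = (\<Sum>m \<in> S. h (Poly_Mapping.lookup p m) * w m)"
  unfolding pm_eval_def
  by (rule sum.mono_neutral_left) (use assms in \<open>auto simp: in_keys_iff\<close>)

lemma poly_mapping_eq_sum_single:
  "p = (\<Sum>m \<in> Poly_Mapping.keys p. Poly_Mapping.single m (Poly_Mapping.lookup p m))"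
  by (rule poly_mapping_eqI)
    (auto simp: lookup_sum lookup_single when_def in_keys_iff if_distrib sum.delta cong: if_cong)

text \<open>Universal property of the monoid ring. Additivity follows by summing over a common
  finite set of indices; multiplicativity follows by expanding both factors into
  \<open>single\<close> terms, on which it reduces to \<open>w_add\<close>.\<close>

lemma comm_ring_hom_pm_eval:
  fixes h :: "'b::comm_ring_1 \<Rightarrow> 'c::comm_ring_1" and w :: "'m::comm_monoid_add \<Rightarrow> 'c"
  assumes "comm_ring_hom h" and w_0: "w 0 = 1" and w_add: "\<And>x y. w (x + y) = w x * w y"
  shows "comm_ring_hom (pm_eval h w)"
proof -
  interpret h: comm_ring_hom h by fact
  have add: "pm_eval h w (p + q) = pm_eval h w p + pm_eval h w q" for p q
  proof -
    let ?S = "Poly_Mapping.keys p \<union> Poly_Mapping.keys q"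
    have "pm_eval h w r = (\<Sum>m \<in> ?S. h (Poly_Mapping.lookup r m) * w m)" if "r \<in> {p, q, p + q}" for r
      using that keys_add[of p q] by (intro pm_eval_superset) auto
    then show ?thesis
      by (simp add: lookup_add h.hom_add distrib_right sum.distrib)
  qed
  have zero: "pm_eval h w 0 = 0"
    by (simp add: pm_eval_def)
  have sum: "pm_eval h w (sum g I) = (\<Sum>i \<in> I. pm_eval h w (g i))" for g :: "'i \<Rightarrow> 'm \<Rightarrow>\<^sub>0 'b" and I
    by (induction I rule: infinite_finite_induct) (simp_all add: zero add)
  have single: "pm_eval h w (Poly_Mapping.single m c) = h c * w m" for m c
    by (cases "c = 0") (simp_all add: pm_eval_def)
  have mult: "pm_eval h w (p * q) = pm_eval h w p * pm_eval h w q" for p q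
  proof -
    let ?m = "Poly_Mapping.lookup"
    have "p * q = (\<Sum>x \<in> Poly_Mapping.keys p. Poly_Mapping.single x (?m p x))
        * (\<Sum>y \<in> Poly_Mapping.keys q. Poly_Mapping.single y (?m q y))"
      by (simp flip: poly_mapping_eq_sum_single)
    also have "pm_eval h w \<dots> = (\<Sum>x \<in> Poly_Mapping.keys p. \<Sum>y \<in> Poly_Mapping.keys q.
        (h (?m p x) * w x) * (h (?m q y) * w y))"
      by (simp add: sum_product mult_single sum single h.hom_mult w_add ac_simps)
    also have "\<dots> = pm_eval h w p * pm_eval h w q"
      by (simp add: pm_eval_def sum_product)
    finally show ?thesis .
  qed
  have "pm_eval h w 1 = 1"
    using single[of 0 1] by (simp add: w_0)
  with zero add mult show ?thesis
    by unfold_locales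
qed

lemma comm_ring_hom_id: "comm_ring_hom id"
  by unfold_locales simp_all

lemma comm_ring_hom_mconst: "comm_ring_hom mconst"
  by unfold_locales (simp_all add: mconst_def single_add mult_single)

definition mon_eval :: "(nat \<Rightarrow> 'b::comm_ring_1) \<Rightarrow> (nat \<Rightarrow>\<^sub>0 nat) \<Rightarrow> 'b" where
  "mon_eval f m = (\<Prod>v \<in> Poly_Mapping.keys m. f v ^ Poly_Mapping.lookup m v)"

lemma mon_eval_superset:
  assumes "finite S" "Poly_Mapping.keys m \<subseteq> S"
  shows "mon_eval f m = (\<Prod>v \<in> S. f v ^ Poly_Mapping.lookup m v)"
  unfolding mon_eval_def
  by (rule prod.mono_neutral_left) (use assms in \<open>auto simp: in_keys_iff\<close>)

lemma mon_eval_0: "mon_eval f 0 = 1"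
  by (simp add: mon_eval_def)

lemma mon_eval_add: "mon_eval f (m + m') = mon_eval f m * mon_eval f m'"
proof -
  let ?S = "Poly_Mapping.keys m \<union> Poly_Mapping.keys m'"
  have "mon_eval f r = (\<Prod>v \<in> ?S. f v ^ Poly_Mapping.lookup r v)" if "r \<in> {m, m', m + m'}" for r
    using that keys_add[of m m'] by (intro mon_eval_superset) auto
  then show ?thesis
    by (simp add: lookup_add power_add prod.distrib)
qed

lemma meval_eq_pm_eval: "meval h f = pm_eval h (mon_eval f)"
  by (simp add: fun_eq_iff meval_def pm_eval_def mon_eval_def)

lemma comm_ring_hom_meval: "comm_ring_hom h \<Longrightarrow> comm_ring_hom (meval h f)"
  unfolding meval_eq_pm_eval by (rule comm_ring_hom_pm_eval) (simp_all add: mon_eval_0 mon_eval_add)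

lemma comm_ring_hom_msubst: "comm_ring_hom (msubst f)"
  unfolding msubst_def by (rule comm_ring_hom_meval) (rule comm_ring_hom_mconst)

lemma comm_ring_hom_mvalue: "comm_ring_hom (mvalue \<sigma>)"
  unfolding mvalue_def by (rule comm_ring_hom_meval) (rule comm_ring_hom_id)

text \<open>Source of the composition laws below: a homomorphism can be pushed through the sums,
  products and powers of an evaluation, down to coefficients and variables.\<close>

lemma hom_meval:
  assumes "comm_ring_hom \<phi>"
  shows "\<phi> (meval h f p) = meval (\<lambda>c. \<phi> (h c)) (\<lambda>v. \<phi> (f v)) p"
proof -
  interpret \<phi>: comm_ring_hom \<phi> by fact
  show ?thesis
    by (simp add: meval_def \<phi>.hom_sum \<phi>.hom_prod \<phi>.hom_mult \<phi>.hom_power)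
qed

text \<open>Updates and their inverses are controlled only on \<open>V\<close>; this transports
  equalities that are known there only.\<close>

lemma meval_cong:
  assumes "p \<in> mpolys V" "\<And>v. v \<in> V \<Longrightarrow> f v = f' v"
  shows "meval h f p = meval h f' p"
  unfolding meval_def
  by (intro sum.cong prod.cong arg_cong2[of _ _ _ _ "(*)"] arg_cong2[of _ _ _ _ power] refl assms(2))
    (use assms(1) in \<open>auto simp: mpolys_def mvars_def\<close>)

lemma meval_mconst: "h 0 = 0 \<Longrightarrow> meval h f (mconst c) = h c"
  by (cases "c = 0") (simp_all add: meval_def mconst_def)

lemma meval_mvar: "h 1 = 1 \<Longrightarrow> meval h f (mvar v) = f v"
  by (simp add: meval_def mvar_def)

lemma mconst_0: "mconst 0 = 0"
  by (simp add: mconst_def)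

lemma mconst_1: "mconst 1 = 1"
  by (simp add: mconst_def)

lemma msubst_mconst: "msubst f (mconst c) = mconst c"
  by (simp add: msubst_def meval_mconst mconst_0)

lemma msubst_mvar: "msubst f (mvar v) = f v"
  by (simp add: msubst_def meval_mvar mconst_1)

lemma msubst_cong:
  assumes "p \<in> mpolys V" "\<And>v. v \<in> V \<Longrightarrow> f v = f' v"
  shows "msubst f p = msubst f' p"
  unfolding msubst_def by (rule meval_cong) (use assms in auto)

lemma msubst_msubst: "msubst f (msubst g p) = msubst (\<lambda>v. msubst f (g v)) p"
  using hom_meval[OF comm_ring_hom_msubst[of f], of mconst g p]
  by (simp add: msubst_mconst flip: msubst_def)

text \<open>Evaluating a monomial at the variables themselves gives back its \<open>single\<close>,
  so the sum is the expansion of \<open>p\<close> into its terms.\<close>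

lemma msubst_mvar_id: "msubst mvar p = p"
proof -
  have pow: "mvar v ^ k = Poly_Mapping.single (Poly_Mapping.single v k) 1" for v k
    by (induction k) (simp_all add: mvar_def mult_single flip: single_add)
  have prod: "(\<Prod>v \<in> S. Poly_Mapping.single (g v) (1::'a)) = Poly_Mapping.single (\<Sum>v \<in> S. g v) 1"
    for S and g :: "nat \<Rightarrow> (nat \<Rightarrow>\<^sub>0 nat)"
    by (induction S rule: infinite_finite_induct) (simp_all add: mult_single)
  have "mon_eval mvar m = Poly_Mapping.single m (1::'a)" for m
    by (simp add: mon_eval_def pow prod flip: poly_mapping_eq_sum_single)
  then show ?thesis
    by (simp add: msubst_def meval_eq_pm_eval pm_eval_def mconst_def mult_single
        flip: poly_mapping_eq_sum_single)
qed

section \<open>Closure properties of polynomials in given variables\<close>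

lemma mpolys_0: "0 \<in> mpolys V"
  by (simp add: mpolys_def mvars_def)

lemma mpolys_mconst: "mconst c \<in> mpolys V"
  by (cases "c = 0") (simp_all add: mpolys_def mvars_def mconst_def)

lemma mpolys_mvar: "v \<in> V \<Longrightarrow> mvar v \<in> mpolys V"
  by (simp add: mpolys_def mvars_def mvar_def)

lemma mpolys_add: "p \<in> mpolys V \<Longrightarrow> q \<in> mpolys V \<Longrightarrow> p + q \<in> mpolys V"
  using keys_add[of p q] by (auto simp: mpolys_def mvars_def) blast

lemma mpolys_mult:
  assumes "p \<in> mpolys V" "q \<in> mpolys V"
  shows "p * q \<in> mpolys V"
  unfolding mpolys_def mvars_def
proof (clarsimp, rule ccontr)
  fix m v assume m: "m \<in> Poly_Mapping.keys (p * q)" and v: "v \<in> Poly_Mapping.keys m" "v \<notin> V"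
  from m keys_mult[of p q] obtain a b
    where "m = a + b" "a \<in> Poly_Mapping.keys p" "b \<in> Poly_Mapping.keys q" by blast
  with v assms keys_add[of a b] show False
    unfolding mpolys_def mvars_def by blast
qed

lemma mpolys_sum: "(\<And>i. i \<in> I \<Longrightarrow> g i \<in> mpolys V) \<Longrightarrow> sum g I \<in> mpolys V"
  by (induction I rule: infinite_finite_induct) (simp_all add: mpolys_0 mpolys_add)

lemma mpolys_1: "1 \<in> mpolys V"
  using mpolys_mconst[of 1] by (simp add: mconst_1)

lemma mpolys_prod: "(\<And>i. i \<in> I \<Longrightarrow> g i \<in> mpolys V) \<Longrightarrow> prod g I \<in> mpolys V"
  by (induction I rule: infinite_finite_induct) (simp_all add: mpolys_1 mpolys_mult)

lemma mpolys_power: "p \<in> mpolys V \<Longrightarrow> p ^ k \<in> mpolys V"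
  by (induction k) (simp_all add: mpolys_1 mpolys_mult)

lemma mpolys_msubst:
  assumes "p \<in> mpolys V" "\<And>v. v \<in> V \<Longrightarrow> f v \<in> mpolys W"
  shows "msubst f p \<in> mpolys W"
  unfolding msubst_def meval_def
  by (intro mpolys_sum mpolys_mult mpolys_mconst mpolys_prod mpolys_power assms(2))
    (use assms(1) in \<open>auto simp: mpolys_def mvars_def\<close>)

section \<open>Composition and iteration of updates\<close>

lemma upd_pow_0: "upd_pow \<eta> 0 = mvar"
  by (simp add: upd_pow_def)

lemma upd_pow_Suc: "upd_pow \<eta> (Suc k) = (\<lambda>v. msubst \<eta> (upd_pow \<eta> k v))"
  by (simp add: upd_pow_def upd_comp_def)

lemma is_update_comp: "is_update V \<eta> \<Longrightarrow> is_update V \<tau> \<Longrightarrow> is_update V (\<eta> \<circ>\<^sub>u \<tau>)"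
  by (auto simp: is_update_def upd_comp_def intro: mpolys_msubst)

lemma is_update_pow: "is_update V \<eta> \<Longrightarrow> is_update V (upd_pow \<eta> k)"
  by (induction k) (auto simp: upd_pow_0 upd_pow_Suc is_update_def mpolys_mvar intro: mpolys_msubst)

lemma is_update_of_int: "is_update V \<eta> \<Longrightarrow> is_update V (upd_of_int \<eta>)"
  by (fastforce simp: is_update_def mpolys_def mvars_def upd_of_int_def in_keys_iff map.rep_eq when_def
      split: if_splits)

section \<open>Polynomials are determined by their values at integer points\<close>

text \<open>Uniqueness of base-\<open>B\<close> digits: reduction modulo \<open>B\<close> isolates
  the lowest digit, and cancelling it and dividing by \<open>B\<close> leaves a shorter
  expansion.\<close>

lemma base_expansion_unique:
  fixes f g :: "nat \<Rightarrow> nat"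
  assumes "\<And>i. i < n \<Longrightarrow> f i < B" "\<And>i. i < n \<Longrightarrow> g i < B"
    and "(\<Sum>i<n. B ^ i * f i) = (\<Sum>i<n. B ^ i * g i)" "i < n"
  shows "f i = g i"
  using assms
proof (induction n arbitrary: f g i)
  case (Suc n)
  have split: "(\<Sum>i<Suc n. B ^ i * u i) = u 0 + B * (\<Sum>i<n. B ^ i * u (Suc i))" for u :: "nat \<Rightarrow> nat"
    by (simp add: sum.lessThan_Suc_shift sum_distrib_left mult.assoc del: sum.lessThan_Suc)
  have eq: "f 0 + B * (\<Sum>i<n. B ^ i * f (Suc i)) = g 0 + B * (\<Sum>i<n. B ^ i * g (Suc i))"
    using Suc.prems(3) unfolding split .
  have lt: "f 0 < B" "g 0 < B"
    using Suc.prems(1,2) by auto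
  have fg0: "f 0 = g 0"
    using arg_cong[OF eq, of "\<lambda>x. x mod B"] lt by simp
  have "(\<Sum>i<n. B ^ i * f (Suc i)) = (\<Sum>i<n. B ^ i * g (Suc i))"
    using eq fg0 lt by simp
  then have "f (Suc j) = g (Suc j)" if "j < n" for j
    using Suc.IH[of "f \<circ> Suc" "g \<circ> Suc" j] Suc.prems(1,2) that by simp
  with fg0 Suc.prems(4) show ?case
    by (cases i) auto
qed simp

text \<open>Kronecker substitution: for \<open>B\<close> larger than all exponents,
  \<open>x\<^sub>v \<mapsto> t ^ (B ^ v)\<close> maps distinct monomials to distinct powers of \<open>t\<close>.\<close>

lemma mpoly_eq_0_if_mvalue_eq_0:
  fixes p :: "'a::field_char_0 mpoly"
  assumes "\<And>\<sigma>. mvalue \<sigma> p = 0"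
  shows "p = 0"
proof -
  define K where "K = Poly_Mapping.keys p"
  have fin: "finite K" by (simp add: K_def)
  obtain n where n: "\<And>m v. m \<in> K \<Longrightarrow> v \<in> Poly_Mapping.keys m \<Longrightarrow> v < n"
  proof -
    have "finite (\<Union>m \<in> K. Poly_Mapping.keys m)" using fin by simp
    then show ?thesis
      using that unfolding finite_nat_set_iff_bounded by blast
  qed
  obtain B where B: "\<And>m v. m \<in> K \<Longrightarrow> Poly_Mapping.lookup m v < B"
  proof -
    \<comment> \<open>Variables absent from a monomial have exponent 0, so 0 is inserted to make the
      bound cover them too.\<close>
    have "finite (insert 0 (\<Union>m \<in> K. Poly_Mapping.lookup m ` Poly_Mapping.keys m))" using fin by simp
    then obtain B where "\<forall>x \<in> insert 0 (\<Union>m \<in> K. Poly_Mapping.lookup m ` Poly_Mapping.keys m). x < B"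
      unfolding finite_nat_set_iff_bounded by blast
    then have "Poly_Mapping.lookup m v < B" if "m \<in> K" for m v
      using that by (cases "v \<in> Poly_Mapping.keys m") (auto simp: in_keys_iff)
    then show ?thesis using that by blast
  qed
  define wt where "wt m = (\<Sum>v<n. B ^ v * Poly_Mapping.lookup m v)" for m :: "nat \<Rightarrow>\<^sub>0 nat"
  have inj: "inj_on wt K"
  proof (rule inj_onI, rule poly_mapping_eqI)
    fix m m' v assume m: "m \<in> K" "m' \<in> K" "wt m = wt m'"
    show "Poly_Mapping.lookup m v = Poly_Mapping.lookup m' v"
    proof (cases "v < n")
      case True
      with m B show ?thesis
        using base_expansion_unique[of n "Poly_Mapping.lookup m" B "Poly_Mapping.lookup m'" v]
        by (simp add: wt_def)
    next
      case False
      with n m have "v \<notin> Poly_Mapping.keys m" "v \<notin> Poly_Mapping.keys m'" by blast+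
      then show ?thesis by (simp add: in_keys_iff)
    qed
  qed
  \<comment> \<open>The univariate image of \<open>p\<close> under the Kronecker
    substitution.\<close>
  define q where "q = (\<Sum>m \<in> K. Polynomial.monom (Poly_Mapping.lookup p m) (wt m))"
  \<comment> \<open>For integer \<open>t\<close> the substituted values \<open>t ^ (B ^ v)\<close>
    are integers, so the hypothesis applies to them.\<close>
  have "poly q (of_int t) = 0" for t
  proof -
    have mon: "mon_eval (\<lambda>v. of_int (t ^ (B ^ v)) :: 'a) m = of_int t ^ wt m" if "m \<in> K" for m
    proof -
      have "mon_eval (\<lambda>v. of_int (t ^ (B ^ v)) :: 'a) m
          = (\<Prod>v<n. of_int (t ^ (B ^ v)) ^ Poly_Mapping.lookup m v)"
        using n[OF that] by (intro mon_eval_superset) auto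
      also have "\<dots> = of_int t ^ wt m"
        by (simp add: wt_def power_sum power_mult)
      finally show ?thesis .
    qed
    have "poly q (of_int t) = mvalue (\<lambda>v. t ^ (B ^ v)) p"
      unfolding mvalue_def meval_eq_pm_eval pm_eval_def q_def K_def[symmetric]
      by (simp add: poly_sum poly_monom mon del: of_int_power cong: sum.cong)
    with assms show ?thesis by simp
  qed
  \<comment> \<open>Characteristic 0 makes the integers an infinite set of roots of
    \<open>q\<close>.\<close>
  then have "range of_int \<subseteq> {x. poly q x = 0}" by auto
  moreover have "infinite (range (of_int :: int \<Rightarrow> 'a))"
    by (simp add: finite_image_iff inj_on_def infinite_UNIV_int)
  ultimately have "q = 0"
    using poly_roots_finite finite_subset by blast
  have "Poly_Mapping.lookup p m = 0" if "m \<in> K" for m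
  proof -
    \<comment> \<open>Injectivity of \<open>wt\<close> on \<open>K\<close> prevents any other
      monomial from contributing to this coefficient.\<close>
    have "Polynomial.coeff q (wt m)
        = (\<Sum>m' \<in> K. if m' = m then Poly_Mapping.lookup p m' else 0)"
      unfolding q_def Polynomial.coeff_sum
      by (rule sum.cong) (use inj that in \<open>auto dest: inj_onD\<close>)
    with that fin \<open>q = 0\<close> show ?thesis by simp
  qed
  then show ?thesis
    unfolding K_def by (metis in_keys_iff keys_eq_empty equals0I)
qed

lemma mpoly_eqI_mvalue:
  fixes p q :: "'a::field_char_0 mpoly"
  assumes "\<And>\<sigma>. mvalue \<sigma> p = mvalue \<sigma> q"
  shows "p = q"
proof -
  have "mvalue \<sigma> (p - q) = 0" for \<sigma>
  proof -
    interpret comm_ring_hom "mvalue \<sigma> :: 'a mpoly \<Rightarrow> 'a"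
      by (rule comm_ring_hom_mvalue)
    show ?thesis by (simp add: hom_minus assms)
  qed
  then show ?thesis
    using mpoly_eq_0_if_mvalue_eq_0[of "p - q"] by simp
qed

section \<open>Closure properties of poly-exponential expressions\<close>

text \<open>Turns the existence of a list of terms, in which exponents may repeat, into a condition
  on each coefficient. Repeated exponents only add up polynomials over \<open>V\<close>; conversely,
  the keys of \<open>e\<close> supply the list.\<close>

lemma PE_iff: "e \<in> PE V \<longleftrightarrow> (\<forall>m. Poly_Mapping.lookup e m \<in> mpolys V)"
proof
  assume "e \<in> PE V"
  then show "\<forall>m. Poly_Mapping.lookup e m \<in> mpolys V"
    by (auto simp: PE_def lookup_sum pe_term_def lookup_single when_def mpolys_0 intro!: mpolys_sum)
next
  assume e: "\<forall>m. Poly_Mapping.lookup e m \<in> mpolys V"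
  let ?K = "Poly_Mapping.keys e"
  \<comment> \<open>Numbers the keys from 1, matching the index range in \<open>PE\<close>.\<close>
  obtain g where g: "bij_betw g {1..card ?K} ?K"
    using ex_bij_betw_nat_finite_1[OF finite_keys] by blast
  have "e = (\<Sum>m \<in> ?K. Poly_Mapping.single m (Poly_Mapping.lookup e m))"
    by (rule poly_mapping_eq_sum_single)
  also have "\<dots> = (\<Sum>j = 1..card ?K.
      pe_term (Poly_Mapping.lookup e (g j)) (expmon_pow (g j)) (expmon_base (g j)))"
    by (simp add: pe_term_def flip: sum.reindex_bij_betw[OF g])
  finally show "e \<in> PE V"
    unfolding PE_def mem_Collect_eq using e
    by (intro exI[of _ "card ?K"] exI[of _ "\<lambda>j. Poly_Mapping.lookup e (g j)"]
        exI[of _ "\<lambda>j. expmon_pow (g j)"] exI[of _ "\<lambda>j. expmon_base (g j)"]) blast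
qed

lemma PE_0: "0 \<in> PE V"
  by (simp add: PE_iff mpolys_0)

lemma PE_add: "e \<in> PE V \<Longrightarrow> e' \<in> PE V \<Longrightarrow> e + e' \<in> PE V"
  by (simp add: PE_iff lookup_add mpolys_add)

lemma PE_sum: "(\<And>i. i \<in> I \<Longrightarrow> g i \<in> PE V) \<Longrightarrow> sum g I \<in> PE V"
  by (induction I rule: infinite_finite_induct) (simp_all add: PE_0 PE_add)

lemma PE_single: "p \<in> mpolys V \<Longrightarrow> Poly_Mapping.single m p \<in> PE V"
  by (simp add: PE_iff lookup_single when_def mpolys_0)

lemma PE_1: "1 \<in> PE V"
  using PE_single[OF mpolys_1, of 0] by simp

lemma PE_mult:
  assumes "e \<in> PE V" "e' \<in> PE V"
  shows "e * e' \<in> PE V"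
proof -
  have "e * e' = (\<Sum>x \<in> Poly_Mapping.keys e. Poly_Mapping.single x (Poly_Mapping.lookup e x))
      * (\<Sum>y \<in> Poly_Mapping.keys e'. Poly_Mapping.single y (Poly_Mapping.lookup e' y))"
    by (simp flip: poly_mapping_eq_sum_single)
  also have "\<dots> \<in> PE V"
    using assms
    by (auto simp: sum_product mult_single PE_iff[of e] PE_iff[of e'] intro!: PE_sum PE_single mpolys_mult)
  finally show ?thesis .
qed

lemma PE_prod: "(\<And>i. i \<in> I \<Longrightarrow> g i \<in> PE V) \<Longrightarrow> prod g I \<in> PE V"
  by (induction I rule: infinite_finite_induct) (simp_all add: PE_1 PE_mult)

lemma PE_power: "e \<in> PE V \<Longrightarrow> e ^ k \<in> PE V"
  by (induction k) (simp_all add: PE_1 PE_mult)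

lemma PE_msubst_pe:
  assumes "p \<in> mpolys V" "\<And>v. v \<in> V \<Longrightarrow> cl v \<in> PE W"
  shows "msubst_pe cl p \<in> PE W"
  unfolding msubst_pe_def meval_def pe_term_def
  by (intro PE_sum PE_mult PE_single mpolys_mconst PE_prod PE_power assms(2))
    (use assms(1) in \<open>auto simp: mpolys_def mvars_def\<close>)

lemma PE_pe_subst:
  assumes "e \<in> PE V" "\<And>v. v \<in> V \<Longrightarrow> \<theta> v \<in> mpolys W"
  shows "pe_subst \<theta> e \<in> PE W"
  using assms by (auto simp: PE_iff pe_subst_def map.rep_eq when_def mpolys_0 intro: mpolys_msubst)

section \<open>Specialising n to a natural number\<close>

text \<open>In contrast to \<open>pe_value\<close>, the variables stay symbolic, so a substitution
  can still be applied after n has been fixed.\<close>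

definition pe_at :: "nat \<Rightarrow> pexp \<Rightarrow> alg mpoly" where
  "pe_at k = pm_eval id (\<lambda>m. mconst (of_nat k ^ expmon_pow m * expmon_base m ^ k))"

text \<open>Addition of \<open>expmon\<close> values mirrors multiplication of the terms they stand
  for, so the weights are multiplicative and the universal property applies.\<close>

lemma comm_ring_hom_pe_at: "comm_ring_hom (pe_at k)"
proof -
  interpret c: comm_ring_hom "mconst :: alg \<Rightarrow> alg mpoly"
    by (rule comm_ring_hom_mconst)
  show ?thesis
    unfolding pe_at_def
    by (rule comm_ring_hom_pm_eval)
      (simp_all add: comm_ring_hom_id zero_expmon_def plus_expmon_def power_add power_mult_distrib
        ac_simps flip: c.hom_mult)
qed

lemma pe_value_eq_mvalue_pe_at: "pe_value \<sigma> k e = mvalue \<sigma> (pe_at k e)"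
proof -
  interpret v: comm_ring_hom "mvalue \<sigma> :: alg mpoly \<Rightarrow> alg"
    by (rule comm_ring_hom_mvalue)
  have "mvalue \<sigma> (mconst c) = c" for c :: alg
    by (simp add: mvalue_def meval_mconst)
  then show ?thesis
    by (simp add: pe_value_def pe_at_def pm_eval_def v.hom_sum v.hom_mult mult.assoc)
qed

text \<open>The weights are constants, which a substitution fixes; it therefore acts on the
  polynomial coefficients alone.\<close>

lemma pe_at_pe_subst: "pe_at k (pe_subst \<theta> e) = msubst \<theta> (pe_at k e)"
proof -
  interpret s: comm_ring_hom "msubst \<theta> :: alg mpoly \<Rightarrow> alg mpoly"
    by (rule comm_ring_hom_msubst)
  have lookup: "Poly_Mapping.lookup (pe_subst \<theta> e) m = msubst \<theta> (Poly_Mapping.lookup e m)" for m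
    by (simp add: pe_subst_def map.rep_eq when_def)
  \<comment> \<open>Only an inclusion, since a substitution can send a nonzero coefficient to
    0.\<close>
  have "Poly_Mapping.keys (pe_subst \<theta> e) \<subseteq> Poly_Mapping.keys e"
    by (auto simp: in_keys_iff lookup)
  then have "pe_at k (pe_subst \<theta> e) = (\<Sum>m \<in> Poly_Mapping.keys e.
      msubst \<theta> (Poly_Mapping.lookup e m) * mconst (of_nat k ^ expmon_pow m * expmon_base m ^ k))"
    unfolding pe_at_def by (subst pm_eval_superset[of "Poly_Mapping.keys e"]) (simp_all add: lookup)
  also have "\<dots> = msubst \<theta> (pe_at k e)"
    by (simp add: pe_at_def pm_eval_def s.hom_sum s.hom_mult msubst_mconst)
  finally show ?thesis .
qed

lemma pe_at_msubst_pe: "pe_at k (msubst_pe cl p) = msubst (\<lambda>v. pe_at k (cl v)) p"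
proof -
  have "pe_at k (pe_term (mconst c) 0 1) = mconst c" for c
    by (cases "c = 0") (simp_all add: pe_at_def pm_eval_def pe_term_def mconst_def mult_single)
  then show ?thesis
    by (simp add: msubst_pe_def msubst_def hom_meval[OF comm_ring_hom_pe_at])
qed

text \<open>Closed forms are only required to agree with the iterates at integer points, but by
  Zariski density of these points, this is already an identity of polynomials.\<close>

lemma closed_form_for_iff:
  "closed_form_for V \<eta> n\<^sub>0 v e \<longleftrightarrow> e \<in> PE V \<and> (\<forall>k \<ge> n\<^sub>0. pe_at k e = upd_pow \<eta> k v)"
  unfolding closed_form_for_def pe_value_eq_mvalue_pe_at using mpoly_eqI_mvalue by metis

section \<open>Inverting blockwise linear substitutions\<close>

lemma block_vec_linear_nth:
  assumes "P \<in> carrier_mat (length S) (length S)"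
    and "block_vec \<theta> S = map_mat mconst P *\<^sub>v block_vec mvar S" and "j < length S"
  shows "\<theta> (S ! j) = (\<Sum>l<length S. mconst (P $$ (j, l)) * mvar (S ! l))"
proof -
  have "\<theta> (S ! j) = block_vec \<theta> S $ j"
    using assms(3) by (simp add: block_vec_def vec_of_list_index)
  also have "\<dots> = (\<Sum>l<length S. mconst (P $$ (j, l)) * mvar (S ! l))"
    unfolding assms(2) using assms(1,3)
    by (auto simp: block_vec_def scalar_prod_def vec_of_list_index atLeast0LessThan intro!: sum.cong)
  finally show ?thesis .
qed

text \<open>Substituting linear forms into linear forms multiplies their matrices: the rows of
  \<open>P\<close> applied to the forms given by \<open>Q\<close> have coefficient matrix
  \<open>P * Q\<close>.\<close>

lemma msubst_block_inverse:
  assumes P: "P \<in> carrier_mat (length S) (length S)" and Q: "Q \<in> carrier_mat (length S) (length S)"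
    and \<theta>: "block_vec \<theta> S = map_mat mconst P *\<^sub>v block_vec mvar S"
    and \<tau>: "block_vec \<tau> S = map_mat mconst Q *\<^sub>v block_vec mvar S"
    and PQ: "P * Q = 1\<^sub>m (length S)" and j: "j < length S"
  shows "msubst \<tau> (\<theta> (S ! j)) = mvar (S ! j)"
proof -
  interpret s: comm_ring_hom "msubst \<tau>" by (rule comm_ring_hom_msubst)
  interpret c: comm_ring_hom mconst by (rule comm_ring_hom_mconst)
  let ?n = "length S"
  have entry: "(\<Sum>l<?n. P $$ (j, l) * Q $$ (l, r)) = (if j = r then 1 else 0)" if "r < ?n" for r
  proof -
    have "(\<Sum>l<?n. P $$ (j, l) * Q $$ (l, r)) = (P * Q) $$ (j, r)"
      using P Q j that by (auto simp: scalar_prod_def atLeast0LessThan intro!: sum.cong)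
    also have "\<dots> = (if j = r then 1 else 0)"
      unfolding PQ using j that by simp
    finally show ?thesis .
  qed
  have "msubst \<tau> (\<theta> (S ! j)) = (\<Sum>l<?n. mconst (P $$ (j, l)) * \<tau> (S ! l))"
    by (simp add: block_vec_linear_nth[OF P \<theta> j] s.hom_sum s.hom_mult msubst_mconst msubst_mvar)
  also have "\<dots> = (\<Sum>l<?n. \<Sum>r<?n. mconst (P $$ (j, l) * Q $$ (l, r)) * mvar (S ! r))"
    by (simp add: block_vec_linear_nth[OF Q \<tau>] sum_distrib_left c.hom_mult mult.assoc)
  also have "\<dots> = (\<Sum>r<?n. mconst (\<Sum>l<?n. P $$ (j, l) * Q $$ (l, r)) * mvar (S ! r))"
    by (subst sum.swap) (simp add: c.hom_sum sum_distrib_right)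
  also have "\<dots> = (\<Sum>r<?n. if j = r then mvar (S ! r) else 0)"
    by (rule sum.cong) (simp_all add: entry)
  also have "\<dots> = mvar (S ! j)"
    using j by simp
  finally show ?thesis .
qed

text \<open>Blocks share no variable and repeat none, so their entries can be prescribed
  independently. This builds the inverse substitution from the inverse matrices.\<close>

lemma ex_update_with_block_vecs:
  assumes "distinct (concat Ss)"
    and "\<And>i. i < length Ss \<Longrightarrow> g i \<in> carrier_vec (length (Ss ! i))"
  shows "\<exists>\<tau>. \<forall>i < length Ss. block_vec \<tau> (Ss ! i) = g i"
  using assms
proof (induction Ss arbitrary: g)
  case (Cons S Ss)
  obtain \<tau> where \<tau>: "\<And>i. i < length Ss \<Longrightarrow> block_vec \<tau> (Ss ! i) = g (Suc i)"
    using Cons.IH[of "g \<circ> Suc"] Cons.prems(1) Cons.prems(2)[of "Suc _"] by auto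
  \<comment> \<open>The first block is read from an association list; later blocks are disjoint from
    it and keep the values of \<open>\<tau>\<close>.\<close>
  define \<tau>' where "\<tau>' v = (if v \<in> set S then the (map_of (zip S (list_of_vec (g 0))) v) else \<tau> v)" for v
  have g0: "g 0 \<in> carrier_vec (length S)"
    using Cons.prems(2)[of 0] by simp
  have "block_vec \<tau>' S = g 0"
  proof (rule eq_vecI)
    fix j assume "j < dim_vec (g 0)"
    with g0 Cons.prems(1) show "block_vec \<tau>' S $ j = g 0 $ j"
      by (simp add: block_vec_def vec_of_list_index \<tau>'_def map_of_zip_nth list_of_vec_index)
  qed (use g0 in \<open>simp add: block_vec_def\<close>)
  moreover have "block_vec \<tau>' (Ss ! i) = g (Suc i)" if "i < length Ss" for i
  proof -
    have "set (Ss ! i) \<inter> set S = {}"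
      using Cons.prems(1) that by (auto simp: disjoint_iff)
    then have "block_vec \<tau>' (Ss ! i) = block_vec \<tau> (Ss ! i)"
      unfolding block_vec_def
      by (intro arg_cong[of _ _ vec_of_list] map_cong refl) (auto simp: \<tau>'_def)
    with \<tau> that show ?thesis by simp
  qed
  ultimately show ?case
    by (auto simp: nth_Cons split: nat.split intro!: exI[of _ \<tau>'])
qed simp

text \<open>\<open>upd_inv\<close> is a choice, so its defining property requires a witness: the
  update given blockwise by the matrices \<open>Q i\<close>. The two matrix identities yield the two
  composition identities.\<close>

lemma blockwise_linear_invertible:
  assumes part: "is_partition V Ss"
    and P: "\<And>i. i < length Ss \<Longrightarrow> P i \<in> carrier_mat (length (Ss ! i)) (length (Ss ! i))"
    and Q: "\<And>i. i < length Ss \<Longrightarrow> Q i \<in> carrier_mat (length (Ss ! i)) (length (Ss ! i))"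
    and PQ: "\<And>i. i < length Ss \<Longrightarrow> P i * Q i = 1\<^sub>m (length (Ss ! i))"
    and QP: "\<And>i. i < length Ss \<Longrightarrow> Q i * P i = 1\<^sub>m (length (Ss ! i))"
    and \<theta>: "\<And>i. i < length Ss \<Longrightarrow>
      block_vec \<theta> (Ss ! i) = map_mat mconst (P i) *\<^sub>v block_vec mvar (Ss ! i)"
  shows "is_update V \<theta>" and "is_upd_inverse V \<theta> (upd_inv V \<theta>)"
proof -
  have in_block: "\<exists>i j. i < length Ss \<and> j < length (Ss ! i) \<and> v = Ss ! i ! j" if "v \<in> V" for v
    using part that unfolding is_partition_def by (auto simp: in_set_conv_nth) blast
  have linear_update: "is_update V \<phi>"
    if M: "\<And>i. i < length Ss \<Longrightarrow> M i \<in> carrier_mat (length (Ss ! i)) (length (Ss ! i))"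
      and \<phi>: "\<And>i. i < length Ss \<Longrightarrow>
        block_vec \<phi> (Ss ! i) = map_mat mconst (M i) *\<^sub>v block_vec mvar (Ss ! i)" for \<phi> M
    unfolding is_update_def
  proof
    fix v assume "v \<in> V"
    then obtain i j where ij: "i < length Ss" "j < length (Ss ! i)" "v = Ss ! i ! j"
      using in_block by blast
    have "Ss ! i ! l \<in> V" if "l < length (Ss ! i)" for l
      using part ij(1) that unfolding is_partition_def by (auto intro!: bexI[of _ "Ss ! i"])
    then show "\<phi> v \<in> mpolys V"
      using block_vec_linear_nth[OF M[OF ij(1)] \<phi>[OF ij(1)] ij(2)] ij(3)
      by (auto intro!: mpolys_sum mpolys_mult mpolys_mconst mpolys_mvar)
  qed
  show "is_update V \<theta>"
    using P \<theta> by (rule linear_update)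
  have "\<exists>\<tau>. \<forall>i < length Ss. block_vec \<tau> (Ss ! i) = map_mat mconst (Q i) *\<^sub>v block_vec mvar (Ss ! i)"
    using part by (intro ex_update_with_block_vecs carrier_vecI)
      (simp_all add: is_partition_def carrier_matD[OF Q])
  then obtain \<tau> where \<tau>: "\<And>i. i < length Ss \<Longrightarrow>
      block_vec \<tau> (Ss ! i) = map_mat mconst (Q i) *\<^sub>v block_vec mvar (Ss ! i)"
    by blast
  have "is_update V \<tau>"
    using Q \<tau> by (rule linear_update)
  moreover have "(\<theta> \<circ>\<^sub>u \<tau>) v = mvar v \<and> (\<tau> \<circ>\<^sub>u \<theta>) v = mvar v" if "v \<in> V" for v
  proof -
    obtain i j where ij: "i < length Ss" "j < length (Ss ! i)" "v = Ss ! i ! j"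
      using in_block[OF \<open>v \<in> V\<close>] by blast
    show ?thesis
      unfolding upd_comp_def ij(3)
      using msubst_block_inverse[OF P Q \<theta> \<tau> PQ] msubst_block_inverse[OF Q P \<tau> \<theta> QP] ij by blast
  qed
  ultimately have "is_upd_inverse V \<theta> \<tau>"
    by (simp add: is_upd_inverse_def)
  then show "is_upd_inverse V \<theta> (upd_inv V \<theta>)"
    unfolding upd_inv_def by (rule someI[of "is_upd_inverse V \<theta>"])
qed

section \<open>Conjugating iterates and closed forms\<close>

text \<open>The conjugation in intertwining form. One step holds because \<open>\<theta>\<close>
  after \<open>\<tau>\<close> cancels; induction extends it to all iterates. The cancellation is
  known only on \<open>V\<close>, so all intermediate polynomials are shown to lie in
  \<open>mpolys V\<close>.\<close>

lemma msubst_upd_pow_conjugate: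
  assumes \<eta>: "is_update V \<eta>" and \<theta>: "is_update V \<theta>" and inv: "is_upd_inverse V \<theta> \<tau>" and "v \<in> V"
  shows "msubst \<theta> (upd_pow (\<tau> \<circ>\<^sub>u \<eta> \<circ>\<^sub>u \<theta>) k v) = msubst (upd_pow \<eta> k) (\<theta> v)"
  using \<open>v \<in> V\<close>
proof (induction k)
  case 0
  show ?case by (simp add: upd_pow_0 msubst_mvar msubst_mvar_id)
next
  case (Suc k)
  let ?\<eta>' = "\<tau> \<circ>\<^sub>u \<eta> \<circ>\<^sub>u \<theta>"
  have \<tau>: "is_update V \<tau>" and \<theta>\<tau>: "\<And>w. w \<in> V \<Longrightarrow> msubst \<theta> (\<tau> w) = mvar w"
    using inv by (auto simp: is_upd_inverse_def upd_comp_def)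
  have step: "msubst \<theta> (?\<eta>' w) = msubst \<eta> (\<theta> w)" if "w \<in> V" for w
  proof -
    have "msubst \<eta> (\<theta> w) \<in> mpolys V"
      using \<eta> \<theta> that by (auto simp: is_update_def intro: mpolys_msubst)
    then have "msubst (\<lambda>u. msubst \<theta> (\<tau> u)) (msubst \<eta> (\<theta> w)) = msubst mvar (msubst \<eta> (\<theta> w))"
      by (rule msubst_cong) (rule \<theta>\<tau>)
    then show ?thesis
      by (simp add: upd_comp_def msubst_mvar_id msubst_msubst)
  qed
  have pow: "upd_pow ?\<eta>' k v \<in> mpolys V"
    using is_update_pow[OF is_update_comp[OF is_update_comp[OF \<tau> \<eta>] \<theta>]] Suc.prems
    by (auto simp: is_update_def)
  have "msubst \<theta> (upd_pow ?\<eta>' (Suc k) v) = msubst (\<lambda>w. msubst \<theta> (?\<eta>' w)) (upd_pow ?\<eta>' k v)"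
    by (simp add: upd_pow_Suc msubst_msubst)
  also have "\<dots> = msubst (\<lambda>w. msubst \<eta> (\<theta> w)) (upd_pow ?\<eta>' k v)"
    using pow step by (rule msubst_cong)
  also have "\<dots> = msubst \<eta> (msubst \<theta> (upd_pow ?\<eta>' k v))"
    by (simp add: msubst_msubst)
  also have "\<dots> = msubst \<eta> (msubst (upd_pow \<eta> k) (\<theta> v))"
    using Suc by simp
  also have "\<dots> = msubst (upd_pow \<eta> (Suc k)) (\<theta> v)"
    by (simp add: msubst_msubst upd_pow_Suc)
  finally show ?case .
qed

text \<open>Each \<open>k\<close> is treated separately, which preserves the start value. After
  specialisation, intertwining moves \<open>\<theta>\<close> next to \<open>\<tau>\<close>, where
  the two cancel.\<close>

lemma closed_form_conjugate:
  assumes \<eta>: "is_update V \<eta>" and \<theta>: "is_update V \<theta>" and inv: "is_upd_inverse V \<theta> \<tau>"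
    and cl: "closed_form V (\<tau> \<circ>\<^sub>u \<eta> \<circ>\<^sub>u \<theta>) n\<^sub>0 cl"
  shows "closed_form V \<eta> n\<^sub>0 (\<lambda>v. pe_subst \<theta> (msubst_pe cl (\<tau> v)))"
  unfolding closed_form_def closed_form_for_iff
proof (intro ballI conjI allI impI)
  let ?\<eta>' = "\<tau> \<circ>\<^sub>u \<eta> \<circ>\<^sub>u \<theta>"
  have cl_PE: "cl w \<in> PE V" and cl_at: "\<And>k. n\<^sub>0 \<le> k \<Longrightarrow> pe_at k (cl w) = upd_pow ?\<eta>' k w"
    if "w \<in> V" for w
    using cl that by (auto simp: closed_form_def closed_form_for_iff)
  fix v assume v: "v \<in> V"
  with inv have \<tau>: "\<tau> v \<in> mpolys V" and \<theta>\<tau>: "msubst \<theta> (\<tau> v) = mvar v"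
    by (auto simp: is_upd_inverse_def is_update_def upd_comp_def)
  show "pe_subst \<theta> (msubst_pe cl (\<tau> v)) \<in> PE V"
    using \<tau> \<theta> cl_PE by (auto simp: is_update_def intro!: PE_pe_subst PE_msubst_pe)
  fix k assume k: "n\<^sub>0 \<le> k"
  have "pe_at k (pe_subst \<theta> (msubst_pe cl (\<tau> v)))
      = msubst (\<lambda>w. msubst \<theta> (pe_at k (cl w))) (\<tau> v)"
    by (simp add: pe_at_pe_subst pe_at_msubst_pe msubst_msubst)
  also have "\<dots> = msubst (\<lambda>w. msubst (upd_pow \<eta> k) (\<theta> w)) (\<tau> v)"
    by (rule msubst_cong[OF \<tau>]) (simp add: cl_at k msubst_upd_pow_conjugate[OF \<eta> \<theta> inv])
  also have "\<dots> = msubst (upd_pow \<eta> k) (msubst \<theta> (\<tau> v))"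
    by (simp add: msubst_msubst)
  also have "\<dots> = upd_pow \<eta> k v"
    by (simp add: \<theta>\<tau> msubst_mvar)
  finally show "pe_at k (pe_subst \<theta> (msubst_pe cl (\<tau> v))) = upd_pow \<eta> k v" .
qed

theorem theorem1:
  fixes d n\<^sub>0 :: nat
    and \<eta>\<^sub>s :: "int update"
    and Ss :: "nat list list"
    and A :: "nat \<Rightarrow> int mat"
    and P :: "nat \<Rightarrow> alg mat"
    and \<theta> \<eta>\<^sub>t :: "alg update"
    and cl\<^sub>t cl\<^sub>s :: "nat \<Rightarrow> pexp"
  defines "V \<equiv> {1..d}"
  assumes solvable: "solvable_with V \<eta>\<^sub>s Ss A"
    and jordan: "\<And>i. i < length Ss \<Longrightarrow> jordan_transformation (map_mat of_int (A i)) (P i)"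
    and theta: "\<And>i. i < length Ss \<Longrightarrow>
        block_vec \<theta> (Ss ! i) = map_mat mconst (P i) *\<^sub>v block_vec mvar (Ss ! i)"
    and eta_t: "\<eta>\<^sub>t = upd_inv V \<theta> \<circ>\<^sub>u upd_of_int \<eta>\<^sub>s \<circ>\<^sub>u \<theta>"
    and twn: "twn d \<eta>\<^sub>t"
    and cl_t: "closed_form V \<eta>\<^sub>t n\<^sub>0 cl\<^sub>t"
    and cl_s: "\<And>v. v \<in> V \<Longrightarrow> cl\<^sub>s v = pe_subst \<theta> (msubst_pe cl\<^sub>t (upd_inv V \<theta> v))"
  shows "closed_form V (upd_of_int \<eta>\<^sub>s) n\<^sub>0 cl\<^sub>s"
proof -
  have part: "is_partition V Ss" and upd: "is_update V \<eta>\<^sub>s"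
    and A: "\<And>i. i < length Ss \<Longrightarrow> A i \<in> carrier_mat (length (Ss ! i)) (length (Ss ! i))"
    using solvable by (auto simp: solvable_with_def)
  have "\<exists>Q. P i \<in> carrier_mat (length (Ss ! i)) (length (Ss ! i))
      \<and> Q \<in> carrier_mat (length (Ss ! i)) (length (Ss ! i))
      \<and> P i * Q = 1\<^sub>m (length (Ss ! i)) \<and> Q * P i = 1\<^sub>m (length (Ss ! i))" if i: "i < length Ss" for i
  proof -
    obtain J Q where "similar_mat_wit J (map_mat of_int (A i)) (P i) Q"
      using jordan[OF i] by (auto simp: jordan_transformation_def)
    \<comment> \<open>The similarity is reversed so that all dimensions can be read off from
      \<open>A i\<close>, whose size is known, instead of from \<open>J\<close>.\<close>
    then have sim: "similar_mat_wit (map_mat of_int (A i)) J Q (P i)"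
      by (rule similar_mat_wit_sym)
    have "map_mat of_int (A i) \<in> carrier_mat (length (Ss ! i)) (length (Ss ! i))"
      using A[OF i] by simp
    note D = similar_mat_witD2[OF this sim]
    show ?thesis
      by (intro exI[of _ Q] conjI D)
  qed
  then obtain Q where Q: "\<And>i. i < length Ss \<Longrightarrow>
      P i \<in> carrier_mat (length (Ss ! i)) (length (Ss ! i))
      \<and> Q i \<in> carrier_mat (length (Ss ! i)) (length (Ss ! i))
      \<and> P i * Q i = 1\<^sub>m (length (Ss ! i)) \<and> Q i * P i = 1\<^sub>m (length (Ss ! i))"
    by metis
  have \<theta>: "is_update V \<theta>" and inv: "is_upd_inverse V \<theta> (upd_inv V \<theta>)"
    using blockwise_linear_invertible[OF part, of P Q \<theta>] Q theta by blast+
  have "closed_form V (upd_of_int \<eta>\<^sub>s) n\<^sub>0 (\<lambda>v. pe_subst \<theta> (msubst_pe cl\<^sub>t (upd_inv V \<theta> v)))"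
    using is_update_of_int[OF upd] \<theta> inv cl_t unfolding eta_t by (rule closed_form_conjugate)
  then show ?thesis
    by (simp add: closed_form_def cl_s)
qed

end
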